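(* Let $n$ be a positive integer. Then, as formal power series in $x$, $$\sum_{\lambda}x^{|\lambda|}\;=\;\prod_{i=1}^{n}\frac{1}{1-x^{2i-1}},$$ where the sum is taken over all lecture hall partitions $\lambda=(\lambda_1,\ldots,\lambda_n)$ with $n$ parts, and $|\lambda|=\sum_{i=1}^n\lambda_i$.
   Context: A lecture hall partition with $n$ parts is a sequence of non-negative integers $\lambda=(\lambda_1,\lambda_2,\ldots,\lambda_n)$ (zero parts allowed) satisfying $$0\le \frac{\lambda_1}{1}\le\frac{\lambda_2}{2}\le\cdots\le\frac{\lambda_n}{n}.$$ *)

theory Defs
  imports
    "HOL-Library.FuncSet"
    "HOL-Computational_Algebra.Formal_Power_Series"
    "HOL-Analysis.Infinite_Sum"
begin

text \<open>
  A sequence \<open>(\<lambda>\<^sub>1, \<dots>, \<lambda>\<^sub>n)\<close> is an extensional function on \<open>{1..n}\<close>, so that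
  distinct functions are distinct sequences. Nonnegativity of the parts is built into the type.
\<close>

definition lecture_hall_partitions :: "nat \<Rightarrow> (nat \<Rightarrow> nat) set" where
  "lecture_hall_partitions n =
     {l \<in> {1..n} \<rightarrow>\<^sub>E UNIV.
        \<forall>i. 1 \<le> i \<and> i < n \<longrightarrow> real (l i) / real i \<le> real (l (i + 1)) / real (i + 1)}"

end

theory Submission
  imports Defs
begin

text \<open>
  Let \<open>T\<close> be the sum and \<open>D = l n - l (n - 1) + \<dots>\<close> the alternating sum of a lecture hall partition
  with \<open>n\<close> parts. With its neighbours held fixed, a part ranges over an interval \<open>{lo..hi}\<close>. Reflecting
  every second part, starting from the last but one, in its interval and then appending a new last
  part that exceeds its lower bound by \<open>s\<close> is a bijection from pairs \<open>(l, s)\<close> to lecture hall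
  partitions with \<open>n + 1\<close> parts. Since \<open>lo\<close> and \<open>hi\<close> arise from adding and subtracting the same
  rounded-up quotient, sums of the bounds telescope, and the bijection turns \<open>D\<close> into \<open>D + s\<close> and \<open>T\<close> into
  \<open>T + 2 * D + s\<close>. Hence the generating functions \<open>G n q\<close> of \<open>T + q * D\<close> satisfy
  \<open>G (n + 1) q = G n (q + 2) / (1 - x ^ (q + 1))\<close>, and the theorem is the case \<open>q = 0\<close>.
  This is the argument of Bousquet-Melou and Eriksson (Lecture hall partitions II).
\<close>

section \<open>Generating functions of weighted sets\<close>

text \<open>\<open>card\<close> is 0 on infinite sets, so the coefficients are meaningful only if
  every fibre of \<open>w\<close> is finite; hence the finiteness hypotheses below.\<close>

definition weight_gf :: "'b set \<Rightarrow> ('b \<Rightarrow> nat) \<Rightarrow> 'a :: field fps" where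
  "weight_gf A w = Abs_fps (\<lambda>k. of_nat (card {a \<in> A. w a = k}))"

text \<open>Convergence is coefficientwise: coefficient \<open>k\<close> of a finite partial sum no
  longer changes once the sum contains the whole finite fibre over \<open>k\<close>.\<close>

lemma has_sum_weight_gf:
  assumes "\<And>k. finite {a \<in> A. w a = k}"
  shows "((\<lambda>a. (fps_X :: 'a :: field fps) ^ w a) has_sum weight_gf A w) A"
  unfolding has_sum_def
proof (rule tendsto_fpsI)
  fix k
  have "fps_nth (\<Sum>a\<in>Y. (fps_X :: 'a fps) ^ w a) k = fps_nth (weight_gf A w) k"
    if "finite Y" "{a \<in> A. w a = k} \<subseteq> Y" "Y \<subseteq> A" for Y
  proof -
    have "fps_nth (\<Sum>a\<in>Y. (fps_X :: 'a fps) ^ w a) k = (\<Sum>a\<in>Y. if w a = k then 1 else 0)"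
      by (auto simp: fps_sum_nth intro!: sum.cong)
    also have "\<dots> = of_nat (card {a \<in> Y. w a = k})"
      using that(1) by (simp flip: sum.inter_filter)
    also have "{a \<in> Y. w a = k} = {a \<in> A. w a = k}"
      using that by auto
    finally show ?thesis
      by (simp add: weight_gf_def)
  qed
  then show "\<forall>\<^sub>F Y in finite_subsets_at_top A.
      fps_nth (\<Sum>a\<in>Y. (fps_X :: 'a fps) ^ w a) k = fps_nth (weight_gf A w) k"
    unfolding eventually_finite_subsets_at_top using assms[of k]
    by (intro exI[of _ "{a \<in> A. w a = k}"]) auto
qed

lemma weight_gf_bij_betw:
  assumes "bij_betw h A B" "\<And>a. a \<in> A \<Longrightarrow> w (h a) = v a"
  shows "weight_gf B w = weight_gf A v"
proof -
  have "card {b \<in> B. w b = k} = card {a \<in> A. v a = k}" for k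
  proof -
    have "bij_betw h {a \<in> A. v a = k} {b \<in> B. w b = k}"
      using assms unfolding bij_betw_def inj_on_def by (auto simp: image_iff)
    then show ?thesis
      by (simp add: bij_betw_same_card)
  qed
  then show ?thesis
    by (simp add: weight_gf_def)
qed

text \<open>Splitting pairs into \<open>s = 0\<close> and \<open>s = Suc s'\<close> gives a
  recurrence for the fibre sizes with step \<open>d\<close>, which is multiplication by
  \<open>1 - fps_X ^ d\<close> read off coefficientwise.\<close>

lemma weight_gf_times_nat:
  assumes fin: "\<And>k. finite {a \<in> A. v a = k}" and "d > 0"
  shows "weight_gf (A \<times> UNIV) (\<lambda>(a, s). v a + d * s) = weight_gf A v / (1 - (fps_X :: 'a :: field fps) ^ d)"
proof -
  define S where "S k = {p \<in> A \<times> UNIV. (\<lambda>(a, s). v a + d * s) p = k}" for k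
  have finS: "finite (S k)" for k
  proof (rule finite_subset)
    show "S k \<subseteq> (\<Union>j\<le>k. {a \<in> A. v a = j}) \<times> {..k}"
    proof
      fix p assume "p \<in> S k"
      moreover obtain a s where "p = (a, s)" by fastforce
      moreover have "s \<le> v a + d * s" using \<open>d > 0\<close> by (intro trans_le_add2) simp
      ultimately show "p \<in> (\<Union>j\<le>k. {a \<in> A. v a = j}) \<times> {..k}"
        unfolding S_def by auto
    qed
    show "finite ((\<Union>j\<le>k. {a \<in> A. v a = j}) \<times> {..k})"
      using fin by auto
  qed
  have card_S: "card (S k) = card {a \<in> A. v a = k} + (if d \<le> k then card (S (k - d)) else 0)" for k
  proof -
    define Z where "Z = (\<lambda>a. (a, 0 :: nat)) ` {a \<in> A. v a = k}"
    define P where "P = (if d \<le> k then (\<lambda>(a, s). (a, Suc s)) ` S (k - d) else {})"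
    have "S k = Z \<union> P"
    proof (intro equalityI subsetI)
      fix p assume p: "p \<in> S k"
      obtain a s where as: "p = (a, s)" by fastforce
      show "p \<in> Z \<union> P"
        using p as by (cases s) (force simp: S_def Z_def P_def image_iff)+
    next
      fix p assume "p \<in> Z \<union> P"
      then show "p \<in> S k"
        by (auto simp: S_def Z_def P_def split: if_splits)
    qed
    moreover have "finite Z" "finite P" "Z \<inter> P = {}"
      using fin finS by (auto simp: Z_def P_def)
    moreover have "card Z = card {a \<in> A. v a = k}"
      unfolding Z_def by (rule card_image) (auto simp: inj_on_def)
    moreover have "card P = (if d \<le> k then card (S (k - d)) else 0)"
      unfolding P_def by (auto intro!: card_image simp: inj_on_def)
    ultimately show ?thesis
      by (simp add: card_Un_disjoint)
  qed
  have "weight_gf (A \<times> UNIV) (\<lambda>(a, s). v a + d * s) * (1 - (fps_X :: 'a fps) ^ d) = weight_gf A v"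
  proof (rule fps_ext)
    fix k
    show "fps_nth (weight_gf (A \<times> UNIV) (\<lambda>(a, s). v a + d * s) * (1 - (fps_X :: 'a fps) ^ d)) k
        = fps_nth (weight_gf A v) k"
      using card_S[of k]
      by (auto simp: weight_gf_def S_def right_diff_distrib fps_X_power_mult_right_nth)
  qed
  moreover have "1 - (fps_X :: 'a fps) ^ d \<noteq> 0"
    using \<open>d > 0\<close> by (metis diff_0_right fps_nth_power_0 fps_X_nth fps_one_nth fps_sub_nth
        fps_zero_nth power_eq_0_iff zero_neq_one zero_power)
  ultimately show ?thesis
    by (metis nonzero_mult_div_cancel_right)
qed

section \<open>Reflecting every second part\<close>

text \<open>Cross-multiplied to stay in the naturals, and free of extensionality, so that it also
  applies to a longer sequence cut off at \<open>n\<close>.\<close>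

definition lecture_hall :: "nat \<Rightarrow> (nat \<Rightarrow> nat) \<Rightarrow> bool" where
  "lecture_hall n l \<longleftrightarrow> (\<forall>i. 1 \<le> i \<and> i < n \<longrightarrow> l i * Suc i \<le> l (Suc i) * i)"

lemma lecture_hall_partitions_eq:
  "lecture_hall_partitions n = {l \<in> {1..n} \<rightarrow>\<^sub>E UNIV. lecture_hall n l}"
proof -
  have "real (l i) / real i \<le> real (l (i + 1)) / real (i + 1) \<longleftrightarrow> l i * Suc i \<le> l (Suc i) * i"
    if "1 \<le> i" for l :: "nat \<Rightarrow> nat" and i
  proof -
    have "real (l i) / real i \<le> real (l (i + 1)) / real (i + 1)
        \<longleftrightarrow> real (l i * Suc i) \<le> real (l (Suc i) * i)"
      using that by (simp add: divide_simps algebra_simps)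
    then show ?thesis
      by (simp only: of_nat_le_iff)
  qed
  then show ?thesis
    unfolding lecture_hall_partitions_def lecture_hall_def by (intro Collect_cong) blast
qed

section \<open>Integer bounds for a part between its neighbours\<close>

definition ceil_div :: "nat \<Rightarrow> nat \<Rightarrow> nat" where
  "ceil_div m j = (m + j - 1) div j"

lemma ceil_div_le_iff:
  assumes "j > 0"
  shows "ceil_div m j \<le> t \<longleftrightarrow> m \<le> t * j"
proof -
  have "ceil_div m j \<le> t \<longleftrightarrow> (m + j - 1) div j < Suc t"
    by (simp add: ceil_div_def less_Suc_eq_le)
  also have "\<dots> \<longleftrightarrow> m + j - 1 < Suc t * j"
    using assms by (simp add: div_less_iff_less_mult)
  also have "\<dots> \<longleftrightarrow> m \<le> t * j"
    using assms by auto
  finally show ?thesis .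
qed

lemma ceil_div_le_self: "j > 0 \<Longrightarrow> ceil_div m j \<le> m"
  by (simp add: ceil_div_le_iff)

lemma ceil_div_1 [simp]: "ceil_div m (Suc 0) = m"
  by (simp add: ceil_div_def)

text \<open>For \<open>b = a + c\<close> the right-hand side reduces to
  \<open>a \<le> c * i\<close>, a bound on a rounded-up quotient.\<close>

lemma lower_bound_iff:
  assumes "i > 0"
  shows "a + ceil_div a i \<le> b \<longleftrightarrow> a * Suc i \<le> b * i"
proof (cases "a \<le> b")
  case True
  then obtain c where "b = a + c" by (auto simp: le_iff_add)
  then show ?thesis
    using ceil_div_le_iff[OF assms, of a c] by (simp add: algebra_simps)
next
  case False
  then have "b * i < a * Suc i"
    by (intro le_less_trans[of "b * i" "a * i"]) auto
  with False show ?thesis by auto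
qed

lemma upper_bound_iff:
  "a \<le> b - ceil_div b (Suc i) \<longleftrightarrow> a * Suc i \<le> b * i"
proof (cases "a \<le> b")
  case True
  then obtain c where b: "b = a + c" by (auto simp: le_iff_add)
  have "a \<le> b - ceil_div b (Suc i) \<longleftrightarrow> ceil_div b (Suc i) \<le> c"
    using ceil_div_le_self[of "Suc i" b] b by auto
  then show ?thesis
    using ceil_div_le_iff[of "Suc i" b c] b by (simp add: algebra_simps)
next
  case False
  then have "b * i < a * Suc i"
    by (intro le_less_trans[of "b * i" "a * i"]) auto
  with False show ?thesis by auto
qed

definition lo :: "(nat \<Rightarrow> nat) \<Rightarrow> nat \<Rightarrow> nat" where
  "lo l j = (if j \<le> 1 then 0 else l (j - 1) + ceil_div (l (j - 1)) (j - 1))"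

text \<open>The subtraction never truncates. For \<open>j > 0\<close> it gives
  \<open>lo l (Suc j) + hi l (j - 1) = 2 * l j\<close>, the cancellation behind
  \<open>sum_reflect\<close>.\<close>

definition hi :: "(nat \<Rightarrow> nat) \<Rightarrow> nat \<Rightarrow> nat" where
  "hi l j = l (Suc j) - ceil_div (l (Suc j)) (Suc j)"

lemma lo_Suc: "i > 0 \<Longrightarrow> lo l (Suc i) = l i + ceil_div (l i) i"
  by (simp add: lo_def)

lemma lo_Suc_0 [simp]: "lo l (Suc 0) = 0"
  by (simp add: lo_def)

lemma lecture_hall_iff_lo:
  "lecture_hall n l \<longleftrightarrow> (\<forall>i. 1 \<le> i \<and> i < n \<longrightarrow> lo l (Suc i) \<le> l (Suc i))"
  by (auto simp: lecture_hall_def lo_Suc lower_bound_iff)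

lemma lecture_hall_iff_hi:
  "lecture_hall n l \<longleftrightarrow> (\<forall>i. 1 \<le> i \<and> i < n \<longrightarrow> l i \<le> hi l i)"
  by (auto simp: lecture_hall_def hi_def upper_bound_iff)

lemma lecture_hall_Suc:
  "lecture_hall (Suc n) l \<longleftrightarrow> lecture_hall n l \<and> lo l (Suc n) \<le> l (Suc n)"
  unfolding lecture_hall_iff_lo by (cases n) (auto simp: less_Suc_eq)

lemma lecture_hall_cong:
  assumes "\<And>i. 1 \<le> i \<Longrightarrow> i \<le> n \<Longrightarrow> l i = l' i"
  shows "lecture_hall n l \<longleftrightarrow> lecture_hall n l'"
  using assms by (auto simp: lecture_hall_def)

lemma lecture_hall_between:
  assumes "lecture_hall n l" "1 \<le> j" "j < n"
  shows "lo l j \<le> l j" "l j \<le> hi l j"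
proof -
  show "l j \<le> hi l j"
    using assms by (simp add: lecture_hall_iff_hi)
  show "lo l j \<le> l j"
    using assms by (cases "j = 1") (auto simp: lecture_hall_iff_lo dest!: spec[of _ "j - 1"])
qed

text \<open>The positions that move are \<open>n - 1\<close>, \<open>n - 3\<close>, and so on: never
  two neighbours, and never \<open>n\<close> itself.\<close>

definition reflect :: "nat \<Rightarrow> (nat \<Rightarrow> nat) \<Rightarrow> nat \<Rightarrow> nat" where
  "reflect n l j = (if 1 \<le> j \<and> j < n \<and> odd (n + j) then lo l j + hi l j - l j else l j)"

lemma reflect_outside: "j = 0 \<or> n \<le> j \<Longrightarrow> reflect n l j = l j"
  by (auto simp: reflect_def)

text \<open>The bounds at \<open>j\<close> depend only on the parts at \<open>j - 1\<close> and
  \<open>j + 1\<close>, which have the wrong parity to move.\<close>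

lemma reflect_neighbours:
  assumes "1 \<le> j" "odd (n + j)"
  shows "lo (reflect n l) j = lo l j" "hi (reflect n l) j = hi l j"
proof -
  have "reflect n l (j - 1) = l (j - 1)" "reflect n l (Suc j) = l (Suc j)"
    using assms by (auto simp: reflect_def)
  then show "lo (reflect n l) j = lo l j" "hi (reflect n l) j = hi l j"
    by (simp_all add: lo_def hi_def)
qed

lemma reflect_reflect:
  assumes "lecture_hall n l"
  shows "reflect n (reflect n l) = l"
proof
  fix j
  show "reflect n (reflect n l) j = l j"
    using lecture_hall_between[OF assms, of j] reflect_neighbours[of j n l]
    by (auto simp: reflect_def[of n "reflect n l"]) (auto simp: reflect_def)
qed

text \<open>Of two consecutive positions exactly one has the parity that moves. Its reflected value
  stays in the unchanged interval: the upper bound settles the case of \<open>i\<close>, the lower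
  bound that of \<open>Suc i\<close>.\<close>

lemma lecture_hall_reflect:
  assumes "lecture_hall n l"
  shows "lecture_hall n (reflect n l)"
  unfolding lecture_hall_def
proof (intro allI impI)
  fix i assume i: "1 \<le> i \<and> i < n"
  let ?r = "reflect n l"
  show "?r i * Suc i \<le> ?r (Suc i) * i"
  proof (cases "odd (n + i)")
    case True
    then have "?r i \<le> hi l i"
      using lecture_hall_between[OF assms, of i] i by (simp add: reflect_def)
    then have "?r i \<le> hi ?r i"
      using True i by (simp add: reflect_neighbours)
    then show ?thesis
      by (simp add: hi_def upper_bound_iff)
  next
    case False
    then have "Suc i < n" if "Suc i \<noteq> n"
      using i that by auto
    then have "lo l (Suc i) \<le> ?r (Suc i)"
      using lecture_hall_between[OF assms, of "Suc i"] i False assms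
      by (cases "Suc i = n") (auto simp: reflect_def lecture_hall_iff_lo)
    then have "lo ?r (Suc i) \<le> ?r (Suc i)"
      using False by (simp add: reflect_neighbours)
    then show ?thesis
      using i by (simp add: lo_Suc lower_bound_iff)
  qed
qed

section \<open>The effect on sum and alternating sum\<close>

primrec alt_sum :: "(nat \<Rightarrow> nat) \<Rightarrow> nat \<Rightarrow> int" where
  "alt_sum l 0 = 0"
| "alt_sum l (Suc n) = int (l (Suc n)) - alt_sum l n"

lemma alt_sum_cong: "(\<And>i. 1 \<le> i \<Longrightarrow> i \<le> n \<Longrightarrow> l i = l' i) \<Longrightarrow> alt_sum l n = alt_sum l' n"
  by (induction n) auto

text \<open>The upper bound carries the induction, since parts increase weakly. Nonnegativity makes
  \<open>nat\<close> lossless in \<open>lh_weight\<close>.\<close>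

lemma alt_sum_bounds:
  assumes "lecture_hall n l"
  shows "0 \<le> alt_sum l n \<and> alt_sum l n \<le> int (l n)"
  using assms
proof (induction n)
  case (Suc n)
  then have "0 \<le> alt_sum l n \<and> alt_sum l n \<le> int (l n)" "lo l (Suc n) \<le> l (Suc n)"
    by (auto simp: lecture_hall_Suc)
  then show ?case
    by (cases n) (auto simp: lo_Suc)
qed simp

text \<open>Raising \<open>n\<close> by 2 keeps the parity, so only position \<open>Suc n\<close> is
  newly reflected.\<close>

lemma reflect_Suc_Suc:
  assumes "lecture_hall (Suc (Suc n)) l"
  shows "j \<le> n \<Longrightarrow> reflect (Suc (Suc n)) l j = reflect n l j"
    and "int (reflect (Suc (Suc n)) l (Suc n))
      = int (lo l (Suc n)) + int (l (Suc (Suc n))) - int (ceil_div (l (Suc (Suc n))) (Suc (Suc n))) - int (l (Suc n))"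
    and "reflect (Suc (Suc n)) l (Suc (Suc n)) = l (Suc (Suc n))"
  using lecture_hall_between[OF assms, of "Suc n"]
    ceil_div_le_self[of "Suc (Suc n)" "l (Suc (Suc n))"]
  by (auto simp: reflect_def hi_def of_nat_diff)

text \<open>Here \<open>lo l (Suc n)\<close> is the least part that may be appended. From
  \<open>n\<close> to \<open>n + 2\<close>, the bound \<open>lo l (Suc n)\<close> cancels against
  the induction hypothesis, and the quotient from the new upper bound is absorbed into
  \<open>lo l (n + 3)\<close>.\<close>

lemma sum_reflect:
  assumes "lecture_hall n l"
  shows "alt_sum (reflect n l) n = int (lo l (Suc n)) - alt_sum l n
    \<and> int (\<Sum>i=1..n. reflect n l i) + int (lo l (Suc n)) = int (\<Sum>i=1..n. l i) + 2 * alt_sum l n"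
  using assms
proof (induction n rule: induct_nat_012)
  case (ge2 n)
  have "lecture_hall n l"
    using ge2.prems by (simp add: lecture_hall_Suc)
  note IH = ge2.IH(1)[OF this]
  note step = reflect_Suc_Suc[OF ge2.prems]
  have "alt_sum (reflect (Suc (Suc n)) l) n = alt_sum (reflect n l) n"
    by (intro alt_sum_cong step)
  moreover have "(\<Sum>i=1..n. reflect (Suc (Suc n)) l i) = (\<Sum>i=1..n. reflect n l i)"
    by (intro sum.cong step) auto
  ultimately show ?case
    using IH step(2,3) by (simp add: lo_Suc)
qed (auto simp: reflect_outside lo_Suc)

section \<open>The bijection appending a last part\<close>

definition extend :: "nat \<Rightarrow> (nat \<Rightarrow> nat) \<times> nat \<Rightarrow> nat \<Rightarrow> nat" where
  "extend n = (\<lambda>(l, s). (reflect n l)(Suc n := lo l (Suc n) + s))"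

text \<open>The value \<open>undefined\<close> at \<open>Suc n\<close> restores extensionality on
  \<open>{1..n}\<close>.\<close>

definition restrict_top :: "nat \<Rightarrow> (nat \<Rightarrow> nat) \<Rightarrow> (nat \<Rightarrow> nat) \<times> nat" where
  "restrict_top n l = (reflect n (l(Suc n := undefined)), l (Suc n) - lo l (Suc n))"

lemma lo_eqI: "(\<And>i. 0 < i \<Longrightarrow> j = Suc i \<Longrightarrow> l i = l' i) \<Longrightarrow> lo l j = lo l' j"
  by (cases j) (auto simp: lo_def)

text \<open>Reflection is an involution that fixes part \<open>n\<close>, and for
  \<open>n > 0\<close> the bound at \<open>Suc n\<close> depends on that part alone. So
  \<open>s\<close> can be read off after the reflection.\<close>

lemma bij_betw_extend:
  "bij_betw (extend n) (lecture_hall_partitions n \<times> UNIV) (lecture_hall_partitions (Suc n))"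
proof (rule bij_betw_byWitness[where f' = "restrict_top n"])
  show "\<forall>p \<in> lecture_hall_partitions n \<times> UNIV. restrict_top n (extend n p) = p"
  proof
    fix p assume p: "p \<in> lecture_hall_partitions n \<times> (UNIV :: nat set)"
    obtain l s where ls: "p = (l, s)" by fastforce
    with p have l: "l \<in> {1..n} \<rightarrow>\<^sub>E UNIV" "lecture_hall n l"
      by (auto simp: lecture_hall_partitions_eq)
    have "(extend n (l, s))(Suc n := undefined) = reflect n l"
      using l(1) by (auto simp: extend_def fun_eq_iff reflect_outside PiE_def extensional_def)
    moreover have "lo (extend n (l, s)) (Suc n) = lo l (Suc n)"
      by (rule lo_eqI) (auto simp: extend_def reflect_outside)
    ultimately show "restrict_top n (extend n p) = p"
      using l(2) by (simp add: ls restrict_top_def reflect_reflect) (simp add: extend_def)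
  qed
  show "\<forall>l \<in> lecture_hall_partitions (Suc n). extend n (restrict_top n l) = l"
  proof
    fix l assume "l \<in> lecture_hall_partitions (Suc n)"
    then have l: "lecture_hall n l" "lo l (Suc n) \<le> l (Suc n)"
      by (auto simp: lecture_hall_partitions_eq lecture_hall_Suc)
    let ?m = "l(Suc n := undefined)"
    have m: "lecture_hall n ?m"
      using l(1) lecture_hall_cong[of n l ?m] by auto
    have "lo (reflect n ?m) (Suc n) = lo l (Suc n)"
      by (rule lo_eqI) (auto simp: reflect_outside)
    then show "extend n (restrict_top n l) = l"
      using l(2) by (auto simp: extend_def restrict_top_def reflect_reflect[OF m])
  qed
  show "extend n ` (lecture_hall_partitions n \<times> UNIV) \<subseteq> lecture_hall_partitions (Suc n)"
  proof safe
    fix l and s :: nat assume "l \<in> lecture_hall_partitions n"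
    then have l: "l \<in> {1..n} \<rightarrow>\<^sub>E UNIV" "lecture_hall n l"
      by (auto simp: lecture_hall_partitions_eq)
    have "lecture_hall n (extend n (l, s))"
      using lecture_hall_reflect[OF l(2)] lecture_hall_cong[of n "reflect n l" "extend n (l, s)"]
      by (auto simp: extend_def)
    moreover have "lo (extend n (l, s)) (Suc n) = lo l (Suc n)"
      by (rule lo_eqI) (auto simp: extend_def reflect_outside)
    ultimately have "lecture_hall (Suc n) (extend n (l, s))"
      by (simp add: lecture_hall_Suc) (simp add: extend_def)
    then show "extend n (l, s) \<in> lecture_hall_partitions (Suc n)"
      using l(1) by (auto simp: lecture_hall_partitions_eq extend_def PiE_def extensional_def reflect_def)
  qed
  show "restrict_top n ` lecture_hall_partitions (Suc n) \<subseteq> lecture_hall_partitions n \<times> UNIV"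
  proof safe
    fix l m s assume l: "l \<in> lecture_hall_partitions (Suc n)" and ms: "(m, s) = restrict_top n l"
    let ?m = "l(Suc n := undefined)"
    have "lecture_hall n ?m"
      using l lecture_hall_cong[of n l ?m] by (auto simp: lecture_hall_partitions_eq lecture_hall_Suc)
    then have "lecture_hall n m"
      using ms lecture_hall_reflect by (simp add: restrict_top_def)
    then show "m \<in> lecture_hall_partitions n"
      using l ms by (auto simp: lecture_hall_partitions_eq restrict_top_def PiE_def extensional_def reflect_def)
  qed simp
qed

section \<open>Weights and the product formula\<close>

definition lh_weight :: "nat \<Rightarrow> nat \<Rightarrow> (nat \<Rightarrow> nat) \<Rightarrow> nat" where
  "lh_weight n q l = (\<Sum>i=1..n. l i) + q * nat (alt_sum l n)"

lemma lh_weight_extend: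
  assumes "l \<in> lecture_hall_partitions n"
  shows "lh_weight (Suc n) q (extend n (l, s)) = lh_weight n (q + 2) l + (q + 1) * s"
proof -
  have l: "lecture_hall n l"
    using assms by (simp add: lecture_hall_partitions_eq)
  let ?e = "extend n (l, s)"
  have "alt_sum ?e n = alt_sum (reflect n l) n"
    by (rule alt_sum_cong) (simp add: extend_def)
  then have "alt_sum ?e (Suc n) = alt_sum l n + int s"
    using sum_reflect[OF l] by (simp add: extend_def)
  moreover have "(\<Sum>i=1..n. ?e i) = (\<Sum>i=1..n. reflect n l i)"
    by (rule sum.cong) (auto simp: extend_def)
  then have "int (\<Sum>i=1..Suc n. ?e i) = int (\<Sum>i=1..n. l i) + 2 * alt_sum l n + int s"
    using sum_reflect[OF l] by (simp add: extend_def)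
  moreover have "0 \<le> alt_sum l n"
    using alt_sum_bounds[OF l] by simp
  ultimately have "int (lh_weight (Suc n) q ?e) = int (lh_weight n (q + 2) l + (q + 1) * s)"
    unfolding lh_weight_def by (simp del: alt_sum.simps sum.cl_ivl_Suc add: algebra_simps)
  then show ?thesis
    by (simp only: of_nat_eq_iff)
qed

lemma finite_lh_weight: "finite {l \<in> lecture_hall_partitions n. lh_weight n q l = k}"
proof (rule finite_subset)
  show "{l \<in> lecture_hall_partitions n. lh_weight n q l = k} \<subseteq> {1..n} \<rightarrow>\<^sub>E {..k}"
  proof
    fix l assume l: "l \<in> {l \<in> lecture_hall_partitions n. lh_weight n q l = k}"
    have "l i \<le> lh_weight n q l" if "i \<in> {1..n}" for i
      using member_le_sum[of i "{1..n}" l] that by (simp add: lh_weight_def)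
    with l show "l \<in> {1..n} \<rightarrow>\<^sub>E {..k}"
      by (auto simp: lecture_hall_partitions_eq PiE_def)
  qed
  show "finite ({1..n} \<rightarrow>\<^sub>E {..k})"
    by (intro finite_PiE) auto
qed

lemma weight_gf_lecture_hall:
  "weight_gf (lecture_hall_partitions n) (lh_weight n q)
    = (\<Prod>i=1..n. 1 / (1 - (fps_X :: 'a :: field fps) ^ (q + 2 * i - 1)))"
\<comment> \<open>The induction hypothesis is used at \<open>q + 2\<close>.\<close>
proof (induction n arbitrary: q)
  case 0
  have "lecture_hall_partitions 0 = {\<lambda>_. undefined}"
    by (auto simp: lecture_hall_partitions_eq lecture_hall_def)
  then show ?case
    by (auto simp: weight_gf_def lh_weight_def fps_eq_iff)
next
  case (Suc n)
  define F where "F i = 1 / (1 - (fps_X :: 'a fps) ^ (q + 2 * i - 1))" for i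
  have "weight_gf (lecture_hall_partitions (Suc n)) (lh_weight (Suc n) q)
      = (weight_gf (lecture_hall_partitions n \<times> UNIV) (\<lambda>(l, s). lh_weight n (q + 2) l + (q + 1) * s) :: 'a fps)"
    by (rule weight_gf_bij_betw[OF bij_betw_extend]) (auto simp: lh_weight_extend)
  also have "\<dots> = weight_gf (lecture_hall_partitions n) (lh_weight n (q + 2)) / (1 - fps_X ^ (q + 1))"
    by (rule weight_gf_times_nat) (auto intro: finite_lh_weight)
  \<comment> \<open>Factor \<open>i\<close> for \<open>q + 2\<close> is factor \<open>Suc i\<close>
    for \<open>q\<close>; the denominator supplies the missing \<open>F 1\<close>.\<close>
  also have "\<dots> = (\<Prod>i=1..n. F (Suc i)) / (1 - fps_X ^ (q + 1))"
    by (simp add: Suc.IH F_def)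
  also have "\<dots> = F 1 * (\<Prod>i=1..n. F (Suc i))"
    by (simp add: F_def fps_divide_unit)
  also have "\<dots> = (\<Prod>i=1..Suc n. F i)"
    using prod.atLeast_Suc_atMost[of 1 "Suc n" F] prod.shift_bounds_cl_Suc_ivl[of F 1 n] by simp
  finally show ?case
    by (simp add: F_def)
qed

theorem theorem1p1:
  fixes n :: nat
  assumes "n \<ge> 1"
  shows "((\<lambda>l. (fps_X :: 'a :: field fps) ^ (\<Sum>i = 1..n. l i)) has_sum
           (\<Prod>i = 1..n. 1 / (1 - fps_X ^ (2 * i - 1))))
         (lecture_hall_partitions n)"
proof -
  have "((\<lambda>l. (fps_X :: 'a fps) ^ lh_weight n 0 l) has_sum
      weight_gf (lecture_hall_partitions n) (lh_weight n 0)) (lecture_hall_partitions n)"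
    by (intro has_sum_weight_gf finite_lh_weight)
  then show ?thesis
    unfolding weight_gf_lecture_hall by (simp add: lh_weight_def)
qed

end
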